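(* Let $M$ be a rank $r$ matroid on $[n]$, $S\subseteq[n]$, $k$ a positive integer, and $H$ the hyperplane $\sum_{e\in S}x_e=k$. Then $H$ gives a hyperplane split of $Q(M)$ if and only if (i) $r(S)>k$ and $r(S^c)>r-k$, and (ii) whenever $I_1,I_2$ are $k$-element independent subsets of $S$ such that $(M/I_1)|_{S^c}$ and $(M/I_2)|_{S^c}$ both have rank $r-k$, we have $(M/I_1)|_{S^c}=(M/I_2)|_{S^c}$.
   Context: $Q(M)=\mathrm{conv}\{e_B: B \text{ a basis of } M\}\subseteq\mathbb{R}^n$ with $e_B=\sum_{b\in B}e_b$ is the matroid base polytope. $r(\cdot)$ is the rank function of $M$, $S^c=[n]\setminus S$. A hyperplane split of $Q(M)$ (by $H$) is a decomposition $Q(M)=Q(M_1)\cup Q(M_2)$, with $Q(M_1)$, $Q(M_2)$ the two pieces of $Q(M)$ on either side of $H$, where $M_1,M_2$ are matroids on $[n]$ and $Q(M_1)\cap Q(M_2)$ is a proper face of both $Q(M_1)$ and $Q(M_2)$. *)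

theory Defs
  imports "HOL-Analysis.Analysis"
begin

record 'a indep_system =
  ground :: "'a set"
  indeps :: "'a set set"

definition matroid :: "'a indep_system \<Rightarrow> bool" where
  "matroid M \<longleftrightarrow>
     finite (ground M) \<and>
     indeps M \<subseteq> Pow (ground M) \<and>
     {} \<in> indeps M \<and>
     (\<forall>I J. I \<in> indeps M \<longrightarrow> J \<subseteq> I \<longrightarrow> J \<in> indeps M) \<and>
     (\<forall>I J. I \<in> indeps M \<longrightarrow> J \<in> indeps M \<longrightarrow> card I < card J \<longrightarrow>
        (\<exists>e\<in>J - I. insert e I \<in> indeps M))"

definition bases :: "'a indep_system \<Rightarrow> 'a set set" where
  "bases M = {B \<in> indeps M. \<forall>I\<in>indeps M. B \<subseteq> I \<longrightarrow> I = B}"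

definition rank_fn :: "'a indep_system \<Rightarrow> 'a set \<Rightarrow> nat" where
  "rank_fn M X = Max (card ` {I \<in> indeps M. I \<subseteq> X})"

definition matroid_rank :: "'a indep_system \<Rightarrow> nat" where
  "matroid_rank M = rank_fn M (ground M)"

definition restriction :: "'a indep_system \<Rightarrow> 'a set \<Rightarrow> 'a indep_system" where
  "restriction M X = \<lparr>ground = ground M \<inter> X, indeps = {I \<in> indeps M. I \<subseteq> X}\<rparr>"

text \<open>For a matroid the choice of the basis \<open>B\<close> of \<open>T\<close> is immaterial, so this is the usual
  contraction \<open>M / T\<close> on the ground set minus \<open>T\<close>.\<close>

definition contraction :: "'a indep_system \<Rightarrow> 'a set \<Rightarrow> 'a indep_system" where
  "contraction M T =
     \<lparr>ground = ground M - T,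
      indeps = {J. J \<subseteq> ground M - T \<and> (\<exists>B\<in>bases (restriction M T). J \<union> B \<in> indeps M)}\<rparr>"

text \<open>The set \<open>{1, \<dots>, n}\<close> is rendered by an arbitrary finite index type \<open>'n\<close>, so that a matroid
  on it is one with \<open>ground M = UNIV\<close>.\<close>

definition base_polytope :: "'n::finite indep_system \<Rightarrow> (real ^ 'n) set" where
  "base_polytope M = convex hull ((\<lambda>B. \<Sum>b\<in>B. axis b 1) ` bases M)"

definition proper_face_of :: "'a::real_vector set \<Rightarrow> 'a set \<Rightarrow> bool" where
  "proper_face_of F P \<longleftrightarrow> F face_of P \<and> F \<noteq> P"

text \<open>The sides of a hyperplane \<open>H\<close> are read off from an equation \<open>a \<bullet> x = b\<close> of \<open>H\<close>; since
  \<open>a \<noteq> 0\<close>, they do not depend on the equation, up to exchanging the two.\<close>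

definition hyperplane_split :: "'n::finite indep_system \<Rightarrow> (real ^ 'n) set \<Rightarrow> bool" where
  "hyperplane_split M H \<longleftrightarrow>
     (\<exists>a b M1 M2. a \<noteq> 0 \<and> H = {x. a \<bullet> x = b} \<and>
        matroid M1 \<and> ground M1 = UNIV \<and>
        matroid M2 \<and> ground M2 = UNIV \<and>
        base_polytope M = base_polytope M1 \<union> base_polytope M2 \<and>
        base_polytope M1 = base_polytope M \<inter> {x. a \<bullet> x \<le> b} \<and>
        base_polytope M2 = base_polytope M \<inter> {x. a \<bullet> x \<ge> b} \<and>
        proper_face_of (base_polytope M1 \<inter> base_polytope M2) (base_polytope M1) \<and>
        proper_face_of (base_polytope M1 \<inter> base_polytope M2) (base_polytope M2))"

end

theory Submission
  imports Defs
begin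

text \<open>Every vertex of the part of \<open>Q(M)\<close> on one side of \<open>H\<close> is the indicator vector of a basis: a new
  vertex would be the point where \<open>H\<close> crosses an edge of \<open>Q(M)\<close>, but the edges have direction
  \<open>e\<^sub>y - e\<^sub>x\<close>, along which \<open>\<Sum>e\<in>S. x\<^sub>e\<close> changes by at most one, so \<open>H\<close> meets them only in
  endpoints. Hence \<open>H\<close> splits \<open>Q(M)\<close> iff there are bases strictly on both sides and the bases \<open>B\<close>
  with \<open>|B \<inter> S| \<le> k\<close>, as well as those with \<open>|B \<inter> S| \<ge> k\<close>, are the bases of a matroid. Each of
  these two conditions amounts to the bases with \<open>|B \<inter> S| = k\<close> forming a product: the part inside
  \<open>S\<close> of one and the part outside \<open>S\<close> of another make up a basis again. In terms of contractions
  this is condition (ii).\<close>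

section \<open>Bases of matroids\<close>

lemma finite_indep:
  assumes "matroid M" "I \<in> indeps M"
  shows "finite I"
  using assms unfolding matroid_def by (meson PowD finite_subset subsetD)

lemma indep_subset: "matroid M \<Longrightarrow> I \<in> indeps M \<Longrightarrow> J \<subseteq> I \<Longrightarrow> J \<in> indeps M"
  unfolding matroid_def by blast

lemma indep_augment:
  "matroid M \<Longrightarrow> I \<in> indeps M \<Longrightarrow> J \<in> indeps M \<Longrightarrow> card I < card J \<Longrightarrow>
    \<exists>e\<in>J - I. insert e I \<in> indeps M"
  unfolding matroid_def by blast

lemma finite_indeps:
  assumes "matroid M"
  shows "finite (indeps M)"
proof (rule finite_subset)
  show "indeps M \<subseteq> Pow (ground M)" "finite (Pow (ground M))"
    using assms by (auto simp: matroid_def)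
qed

text \<open>Iterated augmentation: every added element comes from \<open>J\<close>, and each one
  shrinks the gap \<open>card J - card I\<close>, on which the induction runs.\<close>

lemma indep_extend:
  assumes M: "matroid M" and I: "I \<in> indeps M" and J: "J \<in> indeps M" and "card I \<le> card J"
  obtains K where "K \<in> indeps M" "I \<subseteq> K" "K \<subseteq> I \<union> J" "card K = card J"
proof -
  have "\<exists>K\<in>indeps M. I \<subseteq> K \<and> K \<subseteq> I \<union> J \<and> card K = card J"
    using I \<open>card I \<le> card J\<close>
  proof (induction "card J - card I" arbitrary: I)
    case 0
    then show ?case by (intro bexI[of _ I]) auto
  next
    case (Suc m)
    then have "card I < card J" by linarith
    then obtain e where e: "e \<in> J - I" "insert e I \<in> indeps M"
      using indep_augment[OF M Suc.prems(1) J] by blast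
    have "card (insert e I) = Suc (card I)"
      using e finite_indep[OF M Suc.prems(1)] by simp
    then have "m = card J - card (insert e I)" "card (insert e I) \<le> card J"
      using Suc.hyps(2) \<open>card I < card J\<close> by linarith+
    from Suc.hyps(1)[OF this(1) e(2) this(2)] show ?case using e(1) by blast
  qed
  then show thesis using that by blast
qed

lemma basis_indep: "B \<in> bases M \<Longrightarrow> B \<in> indeps M"
  by (simp add: bases_def)

lemma rank_fn_ge:
  assumes "matroid M" "I \<in> indeps M" "I \<subseteq> X"
  shows "card I \<le> rank_fn M X"
  unfolding rank_fn_def using finite_indeps[OF assms(1)] assms(2,3) by (intro Max_ge) auto

lemma rank_fn_attained:
  assumes "matroid M"
  obtains I where "I \<in> indeps M" "I \<subseteq> X" "card I = rank_fn M X"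
proof -
  have "rank_fn M X \<in> card ` {I \<in> indeps M. I \<subseteq> X}"
    unfolding rank_fn_def
  proof (rule Max_in)
    show "finite (card ` {I \<in> indeps M. I \<subseteq> X})" using finite_indeps[OF assms] by simp
    have "{} \<in> indeps M" using assms by (simp add: matroid_def)
    then show "card ` {I \<in> indeps M. I \<subseteq> X} \<noteq> {}" by blast
  qed
  then show thesis using that by auto
qed

lemma card_indep_le:
  assumes "matroid M" "I \<in> indeps M"
  shows "card I \<le> matroid_rank M"
  unfolding matroid_rank_def using assms by (intro rank_fn_ge) (auto simp: matroid_def)

lemma bases_iff_card:
  assumes M: "matroid M"
  shows "B \<in> bases M \<longleftrightarrow> B \<in> indeps M \<and> card B = matroid_rank M"
proof
  assume B: "B \<in> bases M"
  then have BI: "B \<in> indeps M" by (simp add: bases_def)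
  obtain J where J: "J \<in> indeps M" "card J = matroid_rank M"
    using rank_fn_attained[OF M] unfolding matroid_rank_def by metis
  obtain K where "K \<in> indeps M" "B \<subseteq> K" "card K = card J"
    using indep_extend[OF M BI J(1)] card_indep_le[OF M BI] J(2) by metis
  then show "B \<in> indeps M \<and> card B = matroid_rank M"
    using B J(2) by (auto simp: bases_def)
next
  assume B: "B \<in> indeps M \<and> card B = matroid_rank M"
  have "I = B" if "I \<in> indeps M" "B \<subseteq> I" for I
    using card_seteq[OF finite_indep[OF M that(1)] that(2)] card_indep_le[OF M that(1)] B by auto
  then show "B \<in> bases M" using B by (auto simp: bases_def)
qed

lemma bases_nonempty:
  assumes "matroid M"
  shows "bases M \<noteq> {}"
proof -
  obtain B where "B \<in> indeps M" "card B = matroid_rank M"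
    using rank_fn_attained[OF assms] unfolding matroid_rank_def by metis
  then show ?thesis using bases_iff_card[OF assms] by blast
qed

lemma indep_extend_to_basis:
  assumes M: "matroid M" and I: "I \<in> indeps M" and B: "B \<in> bases M"
  obtains C where "C \<in> bases M" "I \<subseteq> C" "C \<subseteq> I \<union> B"
proof -
  have "B \<in> indeps M" "card I \<le> card B" "card B = matroid_rank M"
    using card_indep_le[OF M I] B bases_iff_card[OF M] by auto
  then obtain K where "K \<in> indeps M" "I \<subseteq> K" "K \<subseteq> I \<union> B" "card K = matroid_rank M"
    using indep_extend[OF M I, of B] by metis
  then show thesis using that bases_iff_card[OF M] by blast
qed

text \<open>The element \<open>y\<close> is sought on the circuit that \<open>x\<close> closes in
  \<open>B2\<close>. Any such \<open>y\<close> can be swapped for \<open>x\<close> in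
  \<open>B2\<close>, so it remains to find one that extends \<open>B1 - {x}\<close>.\<close>

lemma symmetric_exchange:
  assumes M: "matroid M" and B1: "B1 \<in> bases M" and B2: "B2 \<in> bases M" and x: "x \<in> B1 - B2"
  obtains y where "y \<in> B2 - B1" "insert y (B1 - {x}) \<in> bases M" "insert x (B2 - {y}) \<in> bases M"
proof -
  define r where "r = matroid_rank M"
  note basis = bases_iff_card[OF M, folded r_def]
  have I1: "B1 \<in> indeps M" "card B1 = r" and I2: "B2 \<in> indeps M" "card B2 = r"
    using B1 B2 basis by auto
  have f1: "finite B1" and f2: "finite B2" using I1 I2 finite_indep[OF M] by auto
  have "insert x B2 \<notin> indeps M"
    using card_indep_le[OF M, of "insert x B2"] x f2 I2 by (auto simp: r_def)
  \<comment> \<open>\<open>insert x Y\<close> is the circuit that \<open>x\<close> closes in \<open>B2\<close>\<close>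
  then obtain Y where Y: "Y \<subseteq> B2" "insert x Y \<notin> indeps M"
    and min: "\<And>Z. Z \<subseteq> B2 \<Longrightarrow> insert x Z \<notin> indeps M \<Longrightarrow> card Y \<le> card Z"
    using ex_has_least_nat[of "\<lambda>Y. Y \<subseteq> B2 \<and> insert x Y \<notin> indeps M" B2 card] by blast
  have fY: "finite Y" using Y f2 finite_subset by blast
  have YI: "Y \<in> indeps M" using indep_subset[OF M I2(1) Y(1)] .
  \<comment> \<open>Minimality of \<open>Y\<close> makes \<open>insert x (Y - {y})\<close>
    independent. A basis \<open>C\<close> that extends it within \<open>insert x B2\<close> misses
    \<open>y\<close>, since otherwise it would contain the circuit; counting then determines
    \<open>C\<close>.\<close>
  have swap2: "insert x (B2 - {y}) \<in> bases M" if y: "y \<in> Y" for y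
  proof -
    have "insert x (Y - {y}) \<in> indeps M"
      using min[of "Y - {y}"] Y(1) y fY card_Diff1_less[OF fY y] by fastforce
    then obtain C where C: "C \<in> bases M" "insert x (Y - {y}) \<subseteq> C" "C \<subseteq> insert x (Y - {y}) \<union> B2"
      using indep_extend_to_basis[OF M _ B2] by blast
    have "y \<notin> C"
    proof
      assume "y \<in> C"
      then have "insert x Y \<subseteq> C" using C by blast
      then show False using indep_subset[OF M] C(1) Y(2) basis by blast
    qed
    then have "C \<subseteq> insert x (B2 - {y})" using C(3) Y(1) by blast
    moreover have "card (insert x (B2 - {y})) = r"
    proof -
      have "card (B2 - {y}) = r - 1" "r > 0"
        using I2 f2 y Y(1) by (auto simp: card_gt_0_iff)
      then show ?thesis using x f2 by simp
    qed
    ultimately have "C = insert x (B2 - {y})"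
      using C(1) f2 basis by (intro card_subset_eq) auto
    then show ?thesis using C(1) by simp
  qed
  define A where "A = B1 - {x}"
  have AI: "A \<in> indeps M" using indep_subset[OF M I1(1)] by (auto simp: A_def)
  have cA: "Suc (card A) = r" using x f1 I1(2) unfolding A_def
    by (metis DiffD1 card_Suc_Diff1)
  \<comment> \<open>In terms of spans: otherwise \<open>A\<close> spans \<open>Y\<close>, and
    through the circuit also \<open>x\<close>, although \<open>B1\<close> is independent.\<close>
  have "\<exists>y\<in>Y - A. insert y A \<in> indeps M"
  proof (rule ccontr)
    assume no: "\<not> ?thesis"
    have small: "card Z < r" if Z: "Z \<in> indeps M" "Z \<subseteq> A \<union> Y" for Z
    proof (rule ccontr)
      assume "\<not> card Z < r"
      then obtain e where "e \<in> Z - A" "insert e A \<in> indeps M"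
        using indep_augment[OF M AI Z(1)] cA by auto
      then show False using no Z(2) by blast
    qed
    \<comment> \<open>\<open>Z\<close> has one element fewer than \<open>B1\<close>, so some
      \<open>e\<close> of \<open>B1\<close> augments it. If \<open>e = x\<close>, the circuit would
      be independent; if \<open>e\<close> lies in \<open>A\<close>, an independent
      \<open>r\<close>-set inside \<open>A \<union> Y\<close> arises, which \<open>small\<close>
      excludes.\<close>
    then obtain Z where Z: "Z \<in> indeps M" "Y \<subseteq> Z" "Z \<subseteq> Y \<union> A" "card Z = card A"
      using indep_extend[OF M YI AI] cA YI by (metis less_Suc_eq_le sup_ge2)
    then obtain e where e: "e \<in> B1 - Z" "insert e Z \<in> indeps M"
      using indep_augment[OF M Z(1) I1(1)] cA I1(2) by auto
    show False
    proof (cases "e = x")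
      case True
      then show False using indep_subset[OF M e(2), of "insert x Y"] Z(2) Y(2) by auto
    next
      case False
      then have "insert e Z \<subseteq> A \<union> Y" using e(1) Z(3) by (auto simp: A_def)
      then have "card (insert e Z) < r" using small e(2) by blast
      then show False using e(1) finite_indep[OF M Z(1)] Z(4) cA by simp
    qed
  qed
  then obtain y where y: "y \<in> Y - A" "insert y A \<in> indeps M" by blast
  then have "y \<in> B2 - B1" using Y(1) x by (auto simp: A_def)
  moreover have "insert y (B1 - {x}) \<in> bases M"
    using y cA f1 basis by (auto simp: A_def)
  ultimately show thesis using that swap2 y(1) by blast
qed

text \<open>On a walk from \<open>B\<close> towards \<open>C\<close> by exchanges, the size of the
  part in \<open>S\<close> drops by at most one per step, so it cannot jump over \<open>k\<close>.
  Only elements of \<open>C\<close> enter, which keeps the bases inside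
  \<open>B \<union> C\<close>.\<close>

lemma basis_of_intermediate_size:
  assumes M: "matroid M" and B: "B \<in> bases M" and C: "C \<in> bases M"
    and "card (C \<inter> S) \<le> k" "k \<le> card (B \<inter> S)"
  obtains D where "D \<in> bases M" "D \<subseteq> B \<union> C" "card (D \<inter> S) = k"
proof -
  have "\<exists>D\<in>bases M. D \<subseteq> B \<union> C \<and> card (D \<inter> S) = k"
    using B \<open>k \<le> card (B \<inter> S)\<close>
  proof (induction "card (B - C)" arbitrary: B rule: less_induct)
    case less
    note basis = bases_iff_card[OF M]
    have fin: "finite B" "finite C" using less.prems(1) C finite_indep[OF M] basis by auto
    show ?case
    proof (cases "card (B \<inter> S) = k")
      case True
      then show ?thesis using less.prems by blast
    next
      case False
      then have gt: "k < card (B \<inter> S)" using less.prems by simp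
      have "\<not> B \<subseteq> C"
      proof
        assume "B \<subseteq> C"
        then have "card (B \<inter> S) \<le> card (C \<inter> S)" using fin by (intro card_mono) auto
        then show False using gt assms(4) by simp
      qed
      then obtain x where x: "x \<in> B - C" by blast
      obtain y where y: "y \<in> C - B" "insert y (B - {x}) \<in> bases M"
        using symmetric_exchange[OF M less.prems(1) C x] by blast
      have "card (insert y (B - {x}) - C) < card (B - C)"
        using x y(1) fin by (intro psubset_card_mono) auto
      moreover have "k \<le> card (insert y (B - {x}) \<inter> S)"
      proof -
        have "card (B \<inter> S) - 1 \<le> card (B \<inter> S - {x})"
          using fin by (simp add: card_Diff_singleton_if)
        also have "\<dots> \<le> card (insert y (B - {x}) \<inter> S)"
          using fin by (intro card_mono) auto
        finally show ?thesis using gt by simp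
      qed
      ultimately obtain D where "D \<in> bases M" "D \<subseteq> insert y (B - {x}) \<union> C" "card (D \<inter> S) = k"
        using less.hyps y(2) by blast
      then show ?thesis using x y(1) by blast
    qed
  qed
  then show thesis using that by blast
qed

section \<open>Matroids given by their bases\<close>

definition matroid_of_bases :: "'a set \<Rightarrow> 'a set set \<Rightarrow> 'a indep_system" where
  "matroid_of_bases E F = \<lparr>ground = E, indeps = {I. \<exists>B\<in>F. I \<subseteq> B}\<rparr>"

lemma matroid_of_bases:
  assumes E: "finite E" "F \<subseteq> Pow E" and ne: "F \<noteq> {}" and card: "\<And>B. B \<in> F \<Longrightarrow> card B = r"
    and exch: "\<And>B C x. B \<in> F \<Longrightarrow> C \<in> F \<Longrightarrow> x \<in> B - C \<Longrightarrow> \<exists>y\<in>C - B. insert y (B - {x}) \<in> F"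
  shows "matroid (matroid_of_bases E F)" and "bases (matroid_of_bases E F) = F"
proof -
  have fin: "finite B" if "B \<in> F" for B using that E finite_subset by blast
  have augment: "\<exists>e\<in>J - I. \<exists>D\<in>F. insert e I \<subseteq> D"
    if I: "B \<in> F" "I \<subseteq> B" and J: "C \<in> F" "J \<subseteq> C" and lt: "card I < card J" for I J B C
  proof -
    \<comment> \<open>Among the members of \<open>F\<close> above \<open>I\<close>, \<open>D\<close>
      has the fewest elements outside \<open>I \<union> C\<close>. Exchanging such an element
      against \<open>C\<close> would lower their number, so there are none.\<close>
    obtain D where D: "D \<in> F" "I \<subseteq> D"
      and min: "\<And>D'. D' \<in> F \<Longrightarrow> I \<subseteq> D' \<Longrightarrow> card (D - (I \<union> C)) \<le> card (D' - (I \<union> C))"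
      using ex_has_least_nat[of "\<lambda>D. D \<in> F \<and> I \<subseteq> D" B "\<lambda>D. card (D - (I \<union> C))"] I by blast
    have sub: "D \<subseteq> I \<union> C"
    proof (rule ccontr)
      assume "\<not> ?thesis"
      then obtain x where x: "x \<in> D" "x \<notin> I" "x \<notin> C" by blast
      then obtain y where y: "y \<in> C - D" "insert y (D - {x}) \<in> F" using exch[OF D(1) J(1)] by blast
      have "card (insert y (D - {x}) - (I \<union> C)) < card (D - (I \<union> C))"
        using x y fin[OF D(1)] by (intro psubset_card_mono) auto
      then show False using min[OF y(2)] D(2) x(2) by fastforce
    qed
    \<comment> \<open>Otherwise \<open>D - I\<close>, of size \<open>r - card I\<close>, would fit
      into \<open>C - J\<close>, of the smaller size \<open>r - card J\<close>.\<close>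
    have "\<exists>e\<in>J - I. e \<in> D"
    proof (rule ccontr)
      assume "\<not> ?thesis"
      then have "D - I \<subseteq> C - J" using sub by blast
      then have "card (D - I) \<le> card (C - J)" using fin[OF J(1)] by (intro card_mono) auto
      moreover have "card (D - I) = r - card I"
        using card_Diff_subset[OF finite_subset[OF D(2) fin[OF D(1)]] D(2)] card[OF D(1)] by simp
      moreover have "card (C - J) = r - card J"
        using card_Diff_subset[OF finite_subset[OF J(2) fin[OF J(1)]] J(2)] card[OF J(1)] by simp
      moreover have "card J \<le> r" using card_mono[OF fin[OF J(1)] J(2)] card[OF J(1)] by simp
      ultimately show False using lt by linarith
    qed
    then show ?thesis using D by blast
  qed
  have pow: "{I. \<exists>B\<in>F. I \<subseteq> B} \<subseteq> Pow E" using E(2) by blast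
  show "matroid (matroid_of_bases E F)"
    unfolding matroid_def
  proof (intro conjI allI impI)
    fix I J
    assume "I \<in> indeps (matroid_of_bases E F)" "J \<in> indeps (matroid_of_bases E F)"
      and lt: "card I < card J"
    then obtain B C where "B \<in> F" "I \<subseteq> B" "C \<in> F" "J \<subseteq> C" by (auto simp: matroid_of_bases_def)
    from augment[OF this lt] show "\<exists>e\<in>J - I. insert e I \<in> indeps (matroid_of_bases E F)"
      by (simp add: matroid_of_bases_def)
  next
    fix I J
    assume "I \<in> indeps (matroid_of_bases E F)" "J \<subseteq> I"
    then show "J \<in> indeps (matroid_of_bases E F)"
      by (simp add: matroid_of_bases_def) (meson subset_trans)
  next
    show "indeps (matroid_of_bases E F) \<subseteq> Pow (ground (matroid_of_bases E F))"
      using pow by (simp add: matroid_of_bases_def)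
  qed (use E(1) ne in \<open>simp_all add: matroid_of_bases_def ex_in_conv\<close>)
  show "bases (matroid_of_bases E F) = F"
  proof (intro equalityI subsetI)
    fix B assume "B \<in> bases (matroid_of_bases E F)"
    then show "B \<in> F" by (auto simp: bases_def matroid_of_bases_def)
  next
    fix B assume B: "B \<in> F"
    have "I = B" if C: "C \<in> F" "I \<subseteq> C" "B \<subseteq> I" for C I
    proof -
      have "B = C" using C B card by (intro card_subset_eq fin) auto
      then show ?thesis using C by blast
    qed
    then show "B \<in> bases (matroid_of_bases E F)" using B
      unfolding bases_def matroid_of_bases_def by (simp, blast)
  qed
qed

section \<open>Bases on one side of the hyperplane\<close>

text \<open>Product structure of the bases on the hyperplane. Both the polytope side and the
  contraction side of the theorem are compared with it.\<close>

definition cross_closed :: "'a indep_system \<Rightarrow> 'a set \<Rightarrow> nat \<Rightarrow> bool" where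
  "cross_closed M S k \<longleftrightarrow>
    (\<forall>B\<in>bases M. \<forall>C\<in>bases M. card (B \<inter> S) = k \<longrightarrow> card (C \<inter> S) = k \<longrightarrow>
      (B \<inter> S) \<union> (C - S) \<in> bases M)"

lemma card_Int_Compl:
  fixes B :: "'n::finite set"
  shows "card (B \<inter> S) + card (B \<inter> - S) = card B"
proof -
  have "card (B \<inter> S \<union> B \<inter> - S) = card (B \<inter> S) + card (B \<inter> - S)"
    by (rule card_Un_disjoint) auto
  moreover have "B \<inter> S \<union> B \<inter> - S = B" by blast
  ultimately show ?thesis by simp
qed

text \<open>Passing to the complement only swaps the roles of \<open>B\<close> and \<open>C\<close>.
  This lets results on the lower side of \<open>H\<close> serve for the upper side.\<close>

lemma cross_closed_Compl:
  fixes M :: "'n::finite indep_system"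
  assumes M: "matroid M" and "cross_closed M S k" "k \<le> matroid_rank M"
  shows "cross_closed M (- S) (matroid_rank M - k)"
  unfolding cross_closed_def
proof (intro ballI impI)
  fix B C
  assume B: "B \<in> bases M" "card (B \<inter> - S) = matroid_rank M - k"
    and C: "C \<in> bases M" "card (C \<inter> - S) = matroid_rank M - k"
  have "card (B \<inter> S) = k" "card (C \<inter> S) = k"
    using card_Int_Compl[of B S] card_Int_Compl[of C S] B C assms(3) bases_iff_card[OF M] by auto
  then have "(C \<inter> S) \<union> (B - S) \<in> bases M" using assms(2) B C by (auto simp: cross_closed_def)
  moreover have "(B \<inter> - S) \<union> (C - - S) = (C \<inter> S) \<union> (B - S)" by blast
  ultimately show "(B \<inter> - S) \<union> (C - - S) \<in> bases M" by simp
qed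

text \<open>An exchange in \<open>M\<close> leaves the lower family only if \<open>B\<close> is at
  level \<open>k\<close>, \<open>x\<close> lies outside \<open>S\<close> and \<open>z\<close>
  inside. The product property then supplies another basis to exchange against, one that agrees with
  \<open>B\<close> on \<open>S\<close>.\<close>

lemma lower_bases_exchange:
  fixes M :: "'n::finite indep_system"
  assumes M: "matroid M" and cc: "cross_closed M S k"
    and B: "B \<in> bases M" "card (B \<inter> S) \<le> k" and C: "C \<in> bases M" "card (C \<inter> S) \<le> k"
    and x: "x \<in> B - C"
  shows "\<exists>y\<in>C - B. insert y (B - {x}) \<in> bases M \<and> card (insert y (B - {x}) \<inter> S) \<le> k"
proof -
  note basis = bases_iff_card[OF M]
  obtain z where z: "z \<in> C - B" "insert z (B - {x}) \<in> bases M"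
    using symmetric_exchange[OF M B(1) C(1) x] by blast
  show ?thesis
  proof (cases "card (insert z (B - {x}) \<inter> S) \<le> k")
    case True
    then show ?thesis using z by blast
  next
    case False
    have le: "card (insert z (B - {x}) \<inter> S) \<le> Suc (card ((B - {x}) \<inter> S))"
      by (simp add: Int_insert_left card_insert_if)
    have "x \<notin> S"
    proof
      assume "x \<in> S"
      then have "card ((B - {x}) \<inter> S) < card (B \<inter> S)"
        using x by (intro psubset_card_mono) auto
      then show False using le False B(2) by linarith
    qed
    then have eq: "(B - {x}) \<inter> S = B \<inter> S" by blast
    then have Bk: "card (B \<inter> S) = k" using le False B(2) by simp
    \<comment> \<open>The bad exchange lies above level \<open>k\<close> and \<open>C\<close> does
      not, so some basis between them is exactly at level \<open>k\<close>.\<close>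
    obtain D where D: "D \<in> bases M" "D \<subseteq> insert z (B - {x}) \<union> C" "card (D \<inter> S) = k"
      using basis_of_intermediate_size[OF M z(2) C(1) C(2)] False by auto
    \<comment> \<open>Inside \<open>S\<close> this basis offers nothing that \<open>B\<close> lacks,
      so the exchange partner \<open>y\<close> is forced to lie outside \<open>S\<close> and the
      level stays \<open>k\<close>.\<close>
    have new: "(B \<inter> S) \<union> (D - S) \<in> bases M"
      using cc B(1) D Bk by (auto simp: cross_closed_def)
    have "x \<in> B - ((B \<inter> S) \<union> (D - S))" using x z D(2) \<open>x \<notin> S\<close> by blast
    then obtain y where y: "y \<in> ((B \<inter> S) \<union> (D - S)) - B" "insert y (B - {x}) \<in> bases M"
      using symmetric_exchange[OF M B(1) new] by blast
    then have "y \<notin> S" "y \<in> C - B" using D(2) z by auto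
    moreover from \<open>y \<notin> S\<close> eq Bk have "card (insert y (B - {x}) \<inter> S) \<le> k" by simp
    ultimately show ?thesis using y(2) by blast
  qed
qed

lemma lower_bases_matroid:
  fixes M :: "'n::finite indep_system"
  assumes M: "matroid M" and cc: "cross_closed M S k"
    and ne: "\<exists>B\<in>bases M. card (B \<inter> S) \<le> k"
  obtains N where "matroid N" "ground N = UNIV" "bases N = {B \<in> bases M. card (B \<inter> S) \<le> k}"
proof -
  let ?F = "{B \<in> bases M. card (B \<inter> S) \<le> k}"
  have exch: "\<exists>y\<in>C - B. insert y (B - {x}) \<in> ?F" if "B \<in> ?F" "C \<in> ?F" "x \<in> B - C" for B C x
    using lower_bases_exchange[OF M cc, of B C x] that by simp
  have card: "card B = matroid_rank M" if "B \<in> ?F" for B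
    using that bases_iff_card[OF M] by simp
  have "finite (UNIV :: 'n set)" "?F \<subseteq> Pow UNIV" "?F \<noteq> {}" using ne by auto
  note * = matroid_of_bases[OF this card exch]
  have "ground (matroid_of_bases UNIV ?F) = UNIV" by (simp add: matroid_of_bases_def)
  from that[OF *(1) this *(2)] show thesis .
qed

text \<open>Extend \<open>B \<inter> S\<close> by elements of \<open>C\<close> to a basis
  \<open>D\<close> of \<open>N\<close>. Since \<open>B \<inter> S\<close> already has
  \<open>k\<close> elements, \<open>D\<close> can take no more from \<open>S\<close>; it must take
  the rest from \<open>C - S\<close>, and by cardinality all of it.\<close>

lemma cross_closed_if_lower_bases:
  fixes M N :: "'n::finite indep_system"
  assumes M: "matroid M" and N: "matroid N"
    and bN: "bases N = {B \<in> bases M. card (B \<inter> S) \<le> k}"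
  shows "cross_closed M S k"
  unfolding cross_closed_def
proof (intro ballI impI)
  fix B C
  assume B: "B \<in> bases M" "card (B \<inter> S) = k" and C: "C \<in> bases M" "card (C \<inter> S) = k"
  have BN: "B \<in> bases N" and CN: "C \<in> bases N" using B C bN by auto
  have "B \<inter> S \<in> indeps N" using indep_subset[OF N] BN by (auto simp: bases_def)
  then obtain D where D: "D \<in> bases N" "B \<inter> S \<subseteq> D" "D \<subseteq> (B \<inter> S) \<union> C"
    using indep_extend_to_basis[OF N _ CN] by blast
  have "B \<inter> S = D \<inter> S"
    using D bN B(2) by (intro card_seteq) auto
  then have "D \<subseteq> (B \<inter> S) \<union> (C - S)" using D(3) by blast
  moreover have "card ((B \<inter> S) \<union> (C - S)) \<le> card (B \<inter> S) + card (C - S)" by (rule card_Un_le)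
  then have "card ((B \<inter> S) \<union> (C - S)) \<le> card D"
    using B C D(1) bN card_Int_Compl[of C S] bases_iff_card[OF M] by (simp add: Diff_eq)
  ultimately have "D = (B \<inter> S) \<union> (C - S)" by (intro card_seteq) auto
  then show "(B \<inter> S) \<union> (C - S) \<in> bases M" using D(1) bN by blast
qed

section \<open>Cutting the base polytope\<close>

definition incidence :: "'n::finite set \<Rightarrow> real ^ 'n" where
  "incidence B = (\<Sum>b\<in>B. axis b 1)"

lemma incidence_nth [simp]: "incidence B $ i = (if i \<in> B then 1 else 0)"
  by (simp add: incidence_def axis_def sum_component if_distrib sum.delta cong: if_cong)

lemma inner_incidence: "incidence S \<bullet> x = (\<Sum>e\<in>S. x $ e)"
  by (simp add: incidence_def inner_sum_left inner_axis')

lemma inner_incidence_incidence: "incidence S \<bullet> incidence B = card (B \<inter> S)"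
  by (simp add: inner_incidence sum.If_cases Int_commute)

lemma incidence_eq_iff: "incidence A = incidence B \<longleftrightarrow> A = B"
  by (metis incidence_nth set_eqI zero_neq_one)

lemma inj_incidence: "inj_on incidence F"
  by (simp add: inj_on_def incidence_eq_iff)

lemma base_polytope_eq: "base_polytope M = convex hull (incidence ` bases M)"
  by (simp add: base_polytope_def incidence_def)

lemma incidence_in_hull_iff:
  fixes B :: "'n::finite set"
  shows "incidence B \<in> convex hull (incidence ` F) \<longleftrightarrow> B \<in> F"
proof
  assume hull: "incidence B \<in> convex hull (incidence ` F)"
  show "B \<in> F"
  proof (rule ccontr)
    assume "B \<notin> F"
    \<comment> \<open>this functional attains its maximum over the cube only at the vertex of \<open>B\<close>\<close>
    define w where "w = incidence B - incidence (- B)"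
    have val: "w \<bullet> incidence C = real (card (C \<inter> B)) - real (card (C \<inter> - B))" for C :: "'n set"
      by (simp add: w_def inner_diff_left inner_incidence_incidence)
    have "w \<bullet> incidence C < card B" if "C \<in> F" for C
    proof -
      have "C \<noteq> B" using that \<open>B \<notin> F\<close> by blast
      then consider "\<not> B \<subseteq> C" | "C \<inter> - B \<noteq> {}" by blast
      then show ?thesis
      proof cases
        case 1
        then have "card (C \<inter> B) < card B" by (intro psubset_card_mono) auto
        then show ?thesis using val[of C] by simp
      next
        case 2
        then have "card (C \<inter> - B) > 0" by (simp add: card_gt_0_iff)
        moreover have "card (C \<inter> B) \<le> card B" by (intro card_mono) auto
        ultimately show ?thesis using val[of C] by simp
      qed
    qed
    then have "convex hull (incidence ` F) \<subseteq> {x. w \<bullet> x < card B}"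
      by (intro hull_minimal convex_halfspace_lt) auto
    then show False using hull val[of B] by auto
  qed
qed (auto intro: hull_inc)

text \<open>All bases have the same size, so the polytope lies in the hyperplane where the
  coordinates sum to the rank.\<close>

lemma inner_Compl_on_base_polytope:
  assumes M: "matroid M" and x: "x \<in> base_polytope M"
  shows "incidence (- S) \<bullet> x = matroid_rank M - incidence S \<bullet> x"
proof -
  have "base_polytope M \<subseteq> {x. incidence UNIV \<bullet> x = matroid_rank M}"
    unfolding base_polytope_eq
    by (intro hull_minimal convex_hyperplane)
       (auto simp: inner_incidence_incidence bases_iff_card[OF M])
  moreover have "incidence UNIV = incidence S + incidence (- S)"
    by (simp add: vec_eq_iff)
  ultimately show ?thesis using x by (auto simp: inner_add_left)
qed

section \<open>Directions in which a point can move both ways\<close>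

definition two_sided :: "'v::real_vector set \<Rightarrow> 'v \<Rightarrow> 'v \<Rightarrow> bool" where
  "two_sided P v d \<longleftrightarrow> (\<exists>e>0. \<forall>t. \<bar>t\<bar> \<le> e \<longrightarrow> v + t *\<^sub>R d \<in> P)"

lemma two_sided_diff:
  assumes P: "convex P" and "two_sided P v d1" "two_sided P v d2"
  shows "two_sided P v (d1 - c *\<^sub>R d2)"
proof -
  obtain e1 e2 where e1: "e1 > 0" "\<And>t. \<bar>t\<bar> \<le> e1 \<Longrightarrow> v + t *\<^sub>R d1 \<in> P"
    and e2: "e2 > 0" "\<And>t. \<bar>t\<bar> \<le> e2 \<Longrightarrow> v + t *\<^sub>R d2 \<in> P"
    using assms by (auto simp: two_sided_def)
  \<comment> \<open>The target is the midpoint of \<open>v + (2 * t) *\<^sub>R d1\<close> and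
    \<open>v + (- 2 * t * c) *\<^sub>R d2\<close>, hence the factors 2; adding 1 to
    \<open>\<bar>c\<bar>\<close> avoids a zero denominator.\<close>
  define e where "e = min (e1 / 2) (e2 / (2 * (\<bar>c\<bar> + 1)))"
  have "e > 0" using e1 e2 by (simp add: e_def)
  moreover have "v + t *\<^sub>R (d1 - c *\<^sub>R d2) \<in> P" if t: "\<bar>t\<bar> \<le> e" for t
  proof -
    have "v + (2 * t) *\<^sub>R d1 \<in> P" using t by (intro e1) (simp add: e_def abs_mult)
    moreover have "v + (- 2 * t * c) *\<^sub>R d2 \<in> P"
    proof (rule e2(2))
      have "\<bar>t\<bar> * (2 * (\<bar>c\<bar> + 1)) \<le> e2" using t by (simp add: e_def field_simps)
      then show "\<bar>- 2 * t * c\<bar> \<le> e2" by (simp add: abs_mult algebra_simps)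
    qed
    ultimately have "(1/2) *\<^sub>R (v + (2 * t) *\<^sub>R d1) + (1/2) *\<^sub>R (v + (- 2 * t * c) *\<^sub>R d2) \<in> P"
      using convexD[OF P] by auto
    also have "(1/2) *\<^sub>R (v + (2 * t) *\<^sub>R d1) + (1/2) *\<^sub>R (v + (- 2 * t * c) *\<^sub>R d2)
        = ((1/2) *\<^sub>R v + (1/2) *\<^sub>R v) + t *\<^sub>R (d1 - c *\<^sub>R d2)"
      by (simp add: algebra_simps)
    also have "(1/2) *\<^sub>R v + (1/2) *\<^sub>R v = v"
      by (simp flip: scaleR_left_distrib)
    finally show ?thesis .
  qed
  ultimately show ?thesis unfolding two_sided_def by blast
qed

text \<open>A nonzero \<open>d\<close> would make \<open>v\<close> the midpoint of a proper segment
  in \<open>P\<close>.\<close>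

lemma two_sided_extreme:
  fixes v :: "'v::euclidean_space"
  assumes "v extreme_point_of P" "two_sided P v d"
  shows "d = 0"
proof (rule ccontr)
  assume "d \<noteq> 0"
  obtain e where e: "e > 0" "\<And>t. \<bar>t\<bar> \<le> e \<Longrightarrow> v + t *\<^sub>R d \<in> P"
    using assms(2) by (auto simp: two_sided_def)
  have "midpoint (v + e *\<^sub>R d) (v + (- e) *\<^sub>R d) = v"
    by (simp add: midpoint_def flip: scaleR_2)
  moreover have "v + e *\<^sub>R d \<noteq> v + (- e) *\<^sub>R d"
    using e(1) \<open>d \<noteq> 0\<close> by (simp add: eq_neg_iff_add_eq_0 flip: scaleR_left_distrib)
  ultimately have "v \<in> open_segment (v + e *\<^sub>R d) (v + (- e) *\<^sub>R d)"
    using midpoint_in_open_segment by metis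
  moreover have "v + e *\<^sub>R d \<in> P" "v + (- e) *\<^sub>R d \<in> P" using e(1) e(2)[of e] e(2)[of "- e"] by auto
  ultimately show False using assms(1) by (auto simp: extreme_point_of_def)
qed

lemma two_sided_halfspace_parallel:
  assumes "two_sided P v d" "h \<bullet> d = 0" "h \<bullet> v \<le> k"
  shows "two_sided (P \<inter> {x. h \<bullet> x \<le> k}) v d"
  using assms by (auto simp: two_sided_def inner_add_right)

lemma two_sided_halfspace_interior:
  assumes "two_sided P v d" "h \<bullet> v < k"
  shows "two_sided (P \<inter> {x. h \<bullet> x \<le> k}) v d"
proof -
  obtain e where e: "e > 0" "\<And>t. \<bar>t\<bar> \<le> e \<Longrightarrow> v + t *\<^sub>R d \<in> P"
    using assms(1) by (auto simp: two_sided_def)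
  \<comment> \<open>The second bound caps the gain \<open>t * (h \<bullet> d)\<close> by the slack
    \<open>k - h \<bullet> v\<close>; the 1 keeps the denominator positive when
    \<open>h \<bullet> d = 0\<close>.\<close>
  define e' where "e' = min e ((k - h \<bullet> v) / (\<bar>h \<bullet> d\<bar> + 1))"
  have "e' > 0" using e assms(2) by (simp add: e'_def)
  moreover have "v + t *\<^sub>R d \<in> P \<inter> {x. h \<bullet> x \<le> k}" if t: "\<bar>t\<bar> \<le> e'" for t
  proof -
    have "t * (h \<bullet> d) \<le> \<bar>t\<bar> * (\<bar>h \<bullet> d\<bar> + 1)"
      using abs_ge_self[of "t * (h \<bullet> d)"] by (simp add: abs_mult algebra_simps)
    also have "\<dots> \<le> k - h \<bullet> v" using t by (simp add: e'_def field_simps)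
    finally show ?thesis using t e(2) by (simp add: e'_def inner_add_right)
  qed
  ultimately show ?thesis unfolding two_sided_def by blast
qed

text \<open>Shifting weight from \<open>B\<close> to \<open>C\<close> moves the point along
  \<open>g C - g B\<close>, and shifting weight from \<open>B'\<close> to \<open>C'\<close> moves it
  back the other way. The positive weights of \<open>B\<close> and \<open>B'\<close> leave room for
  both.\<close>

lemma two_sided_convex_combination:
  fixes g :: "'b \<Rightarrow> 'v::real_vector" and u :: "'b \<Rightarrow> real"
  assumes fin: "finite F" and u: "\<And>D. D \<in> F \<Longrightarrow> 0 \<le> u D" "sum u F = 1"
    and F: "B \<in> F" "C \<in> F" "B' \<in> F" "C' \<in> F" and pos: "u B > 0" "u B' > 0"
    and opp: "g C' - g B' = - (g C - g B)"
  shows "two_sided (convex hull (g ` F)) (\<Sum>D\<in>F. u D *\<^sub>R g D) (g C - g B)"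
proof -
  let ?v = "\<Sum>D\<in>F. u D *\<^sub>R g D"
  have shift: "?v + t *\<^sub>R (g C - g B) \<in> convex hull (g ` F)"
    if BC: "B \<in> F" "C \<in> F" and t: "0 \<le> t" "t \<le> u B" for B C t
  proof -
    \<comment> \<open>Two separate corrections, so that they cancel when
      \<open>B = C\<close>.\<close>
    define w where "w D = u D + ((if D = C then t else 0) - (if D = B then t else 0))" for D
    have "(\<Sum>D\<in>F. w D *\<^sub>R g D) \<in> convex hull (g ` F)"
    proof (rule convex_sum[OF fin convex_convex_hull])
      show "sum w F = 1"
        using u(2) BC fin by (simp add: w_def sum.distrib sum_subtractf)
      show "0 \<le> w D" if "D \<in> F" for D using u(1)[OF that] t by (auto simp: w_def)
      show "g D \<in> convex hull (g ` F)" if "D \<in> F" for D using that by (auto intro: hull_inc)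
    qed
    also have "(\<Sum>D\<in>F. w D *\<^sub>R g D) = ?v + t *\<^sub>R (g C - g B)"
    proof -
      have "w D *\<^sub>R g D = u D *\<^sub>R g D +
          ((if D = C then t *\<^sub>R g D else 0) - (if D = B then t *\<^sub>R g D else 0))" for D
        by (simp add: w_def algebra_simps)
      then show ?thesis
        using BC fin by (simp add: sum.distrib sum_subtractf scaleR_diff_right)
    qed
    finally show ?thesis .
  qed
  have "?v + t *\<^sub>R (g C - g B) \<in> convex hull (g ` F)" if "\<bar>t\<bar> \<le> min (u B) (u B')" for t
  proof (cases "0 \<le> t")
    case True
    then show ?thesis using shift[OF F(1,2)] that by simp
  next
    case False
    then have "?v + (- t) *\<^sub>R (g C' - g B') \<in> convex hull (g ` F)"
      using that by (intro shift F) auto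
    also have "(- t) *\<^sub>R (g C' - g B') = t *\<^sub>R (g C - g B)" unfolding opp by (simp add: algebra_simps)
    finally show ?thesis .
  qed
  then show ?thesis using pos unfolding two_sided_def
    by (intro exI[of _ "min (u B) (u B')"]) auto
qed

text \<open>If the extreme point \<open>v\<close> were not a vertex of the base polytope, then any two bases in a
  representation of \<open>v\<close> would yield, by symmetric exchange, a direction \<open>e\<^sub>y - e\<^sub>x\<close> along which
  one can move both ways from \<open>v\<close>. Extremality leaves room for at most one such line, and it
  has to cross the hyperplane, so the two bases differ by one such exchange. On the other hand, since
  \<open>v\<close> lies on the hyperplane at integer height, there are two bases for which this is not so.\<close>

lemma extreme_point_is_vertex:
  fixes M :: "'n::finite indep_system" and k :: nat
  assumes M: "matroid M"
    and ext: "v extreme_point_of (base_polytope M \<inter> {x. incidence S \<bullet> x \<le> k})"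
  shows "v \<in> incidence ` bases M"
proof (rule ccontr)
  assume nv: "v \<notin> incidence ` bases M"
  let ?P = "base_polytope M"
  let ?K = "?P \<inter> {x. incidence S \<bullet> x \<le> k}"
  have vP: "v \<in> ?P" and vk: "incidence S \<bullet> v \<le> k"
    using ext by (auto simp: extreme_point_of_def)
  have fin: "finite (bases M)" by simp
  obtain u0 where u0: "\<forall>x\<in>incidence ` bases M. 0 \<le> u0 x" "sum u0 (incidence ` bases M) = 1"
    "(\<Sum>x\<in>incidence ` bases M. u0 x *\<^sub>R x) = v"
    using vP unfolding base_polytope_eq convex_hull_finite[OF finite_imageI[OF fin]] by blast
  define u where "u = u0 \<circ> incidence"
  have u: "\<And>B. B \<in> bases M \<Longrightarrow> 0 \<le> u B" "sum u (bases M) = 1"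
    and v: "v = (\<Sum>B\<in>bases M. u B *\<^sub>R incidence B)"
    using u0 by (auto simp: u_def sum.reindex[OF inj_incidence])
  define T where "T = {B \<in> bases M. u B > 0}"
  have "T \<noteq> {}"
  proof
    assume "T = {}"
    then have "u B = 0" if "B \<in> bases M" for B using u(1)[OF that] that by (force simp: T_def)
    then show False using u(2) by simp
  qed
  then obtain B0 where B0: "B0 \<in> T" by blast
  have "\<exists>B1\<in>T. B1 \<noteq> B0"
  proof (rule ccontr)
    assume "\<not> ?thesis"
    then have z: "u B = 0" if "B \<in> bases M - {B0}" for B using u(1)[of B] that by (force simp: T_def)
    have mem: "B0 \<in> bases M" using B0 by (simp add: T_def)
    have "sum u (bases M) = u B0 + sum u (bases M - {B0})" by (rule sum.remove[OF fin mem])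
    then have "u B0 = 1" using z u(2) by simp
    moreover have "v = u B0 *\<^sub>R incidence B0 + (\<Sum>B\<in>bases M - {B0}. u B *\<^sub>R incidence B)"
      unfolding v by (rule sum.remove[OF fin mem])
    ultimately have "v = incidence B0" using z by simp
    then show False using nv mem by blast
  qed
  then obtain B1 where B1: "B1 \<in> T" "B1 \<noteq> B0" by blast

  have two: "two_sided ?P v (incidence C - incidence B)"
    if "B \<in> T" "B' \<in> T" "C \<in> bases M" "C' \<in> bases M"
      "incidence C' - incidence B' = - (incidence C - incidence B)" for B B' C C'
    unfolding v base_polytope_eq using that u fin
    by (intro two_sided_convex_combination[of _ _ _ _ B' C']) (auto simp: T_def)
  \<comment> \<open>A symmetric exchange changes \<open>B\<close> and \<open>B'\<close> by opposite
    vectors, which is the situation of \<open>two\<close>.\<close>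
  have exch: "\<exists>x y. x \<in> B - B' \<and> y \<in> B' - B \<and> two_sided ?P v (axis y 1 - axis x 1)"
    if B: "B \<in> T" "B' \<in> T" "B \<noteq> B'" for B B'
  proof -
    have bb: "B \<in> bases M" "B' \<in> bases M" using B by (auto simp: T_def)
    then have "card B = card B'" using bases_iff_card[OF M] by simp
    then have "\<not> B \<subseteq> B'" using B(3) card_subset_eq[of B' B] by auto
    then obtain x where x: "x \<in> B - B'" by blast
    obtain y where y: "y \<in> B' - B" "insert y (B - {x}) \<in> bases M" "insert x (B' - {y}) \<in> bases M"
      using symmetric_exchange[OF M bb x] by blast
    have e1: "incidence (insert y (B - {x})) - incidence B = axis y 1 - axis x 1"
      and e2: "incidence (insert x (B' - {y})) - incidence B' = - (axis y 1 - axis x 1)"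
      using x y(1) by (auto simp: vec_eq_iff axis_def)
    have "two_sided ?P v (axis y 1 - axis x 1)"
      using two[OF B(1,2) y(2,3)] e1 e2 by simp
    then show ?thesis using x y by blast
  qed
  have axis_ne: "axis y 1 - axis x 1 \<noteq> (0 :: real ^ 'n)" if "x \<noteq> y" for x y
    using that by (simp add: axis_eq_axis)

  \<comment> \<open>Strictly below the hyperplane, the cut does not obstruct small moves, so any
    two-sided direction in the polytope contradicts extremality.\<close>
  have on: "incidence S \<bullet> v = k"
  proof (rule ccontr)
    assume "incidence S \<bullet> v \<noteq> k"
    then have lt: "incidence S \<bullet> v < k" using vk by simp
    obtain x y where xy: "x \<in> B0 - B1" "y \<in> B1 - B0"
      and ts: "two_sided ?P v (axis y 1 - axis x 1)"
      using exch[OF B0 B1(1) B1(2)[symmetric]] by metis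
    have "axis y 1 - axis x 1 = (0 :: real ^ 'n)"
      using two_sided_extreme[OF ext two_sided_halfspace_interior[OF ts lt]] .
    then show False using axis_ne[of x y] xy by blast
  qed

  \<comment> \<open>Either all bases of positive weight are at level \<open>k\<close>, and any two
    differ by 0; or, the weighted mean of the levels being the integer \<open>k\<close>, one lies
    below and one above, and they differ by at least 2.\<close>
  obtain B B' where B: "B \<in> T" "B' \<in> T" "B \<noteq> B'"
    and far: "\<bar>real (card (B' \<inter> S)) - real (card (B \<inter> S))\<bar> \<noteq> 1"
  proof (cases "\<forall>B\<in>T. card (B \<inter> S) = k")
    case True
    then show thesis using that[OF B0 B1(1)] B0 B1 by auto
  next
    case False
    have zero: "(\<Sum>B\<in>bases M. u B * (real (card (B \<inter> S)) - real k)) = 0"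
    proof -
      have "(\<Sum>B\<in>bases M. u B * (real (card (B \<inter> S)) - real k))
          = incidence S \<bullet> v - sum u (bases M) * k"
        by (simp add: v inner_sum_right inner_incidence_incidence right_diff_distrib
            sum_subtractf sum_distrib_right)
      then show ?thesis using on u(2) by simp
    qed
    obtain D where D: "D \<in> T" "card (D \<inter> S) \<noteq> k" using False by blast
    have "\<exists>B\<in>T. card (B \<inter> S) < k"
    proof (rule ccontr)
      assume no: "\<not> ?thesis"
      have "0 \<le> u B * (real (card (B \<inter> S)) - real k)" if "B \<in> bases M" for B
        using u(1)[OF that] no that by (cases "u B = 0") (auto simp: T_def not_less)
      moreover have "u D * (real (card (D \<inter> S)) - real k) > 0"
        using D no by (auto simp: T_def not_less le_less)
      ultimately have "(\<Sum>B\<in>bases M. u B * (real (card (B \<inter> S)) - real k)) > 0"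
        using D(1) by (intro sum_pos2[of _ D]) (auto simp: T_def)
      then show False using zero by simp
    qed
    moreover have "\<exists>B\<in>T. k < card (B \<inter> S)"
    proof (rule ccontr)
      assume no: "\<not> ?thesis"
      have "0 \<le> u B * (real k - real (card (B \<inter> S)))" if "B \<in> bases M" for B
        using u(1)[OF that] no that by (cases "u B = 0") (auto simp: T_def not_less)
      moreover have "u D * (real k - real (card (D \<inter> S))) > 0"
        using D no by (auto simp: T_def not_less le_less)
      ultimately have "(\<Sum>B\<in>bases M. u B * (real k - real (card (B \<inter> S)))) > 0"
        using D(1) by (intro sum_pos2[of _ D]) (auto simp: T_def)
      moreover have "(\<Sum>B\<in>bases M. u B * (real k - real (card (B \<inter> S))))
          = - (\<Sum>B\<in>bases M. u B * (real (card (B \<inter> S)) - real k))"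
        by (simp add: sum_negf[symmetric] algebra_simps)
      ultimately show False using zero by simp
    qed
    ultimately obtain E G where "E \<in> T" "card (E \<inter> S) < k" "G \<in> T" "k < card (G \<inter> S)" by blast
    then show thesis by (intro that[of E G]) auto
  qed
  obtain x y where xy: "x \<in> B - B'" "y \<in> B' - B" and ts: "two_sided ?P v (axis y 1 - axis x 1)"
    using exch[OF B] by blast
  define d :: "real ^ 'n" where "d = axis y 1 - axis x 1"
  have "d \<noteq> 0" using axis_ne[of x y] xy unfolding d_def by blast
  have parallel_zero: "f = 0" if "two_sided ?P v f" "incidence S \<bullet> f = 0" for f
    using two_sided_extreme[OF ext two_sided_halfspace_parallel[OF that vk]] .
  have hd: "incidence S \<bullet> d \<noteq> 0" using parallel_zero[of d] ts \<open>d \<noteq> 0\<close> by (auto simp: d_def)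
  have hd1: "\<bar>incidence S \<bullet> d\<bar> = 1"
    using hd by (auto simp: d_def inner_diff_right inner_axis split: if_splits)
  \<comment> \<open>Chosen so that subtracting \<open>c *\<^sub>R d\<close> leaves a direction
    parallel to the hyperplane, which extremality forces to be zero.\<close>
  define c where "c = (incidence S \<bullet> (incidence B' - incidence B)) / (incidence S \<bullet> d)"
  \<comment> \<open>Here weight is shifted from \<open>B\<close> to \<open>B'\<close> and
    back.\<close>
  have "two_sided ?P v (incidence B' - incidence B)"
    using B two[of B B' B' B] by (simp add: T_def)
  then have "two_sided ?P v ((incidence B' - incidence B) - c *\<^sub>R d)"
    using ts unfolding d_def by (intro two_sided_diff) (simp_all add: base_polytope_eq)
  moreover have "incidence S \<bullet> ((incidence B' - incidence B) - c *\<^sub>R d) = 0"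
    using hd by (simp add: inner_diff_right c_def)
  ultimately have eq: "incidence B' - incidence B = c *\<^sub>R d"
    using parallel_zero by fastforce
  \<comment> \<open>Coordinate \<open>y\<close> is 1 on the left and in \<open>d\<close>, so it
    reveals \<open>c\<close>. The levels of \<open>B\<close> and \<open>B'\<close> then differ by
    exactly one, against \<open>far\<close>.\<close>
  have "(incidence B' - incidence B) $ y = c * d $ y" unfolding eq by simp
  then have "c = 1" using xy by (auto simp: d_def axis_def split: if_splits)
  then have "real (card (B' \<inter> S)) - real (card (B \<inter> S)) = incidence S \<bullet> d"
    using arg_cong[OF eq, of "\<lambda>z. incidence S \<bullet> z"]
    by (simp add: inner_diff_right inner_incidence_incidence)
  then show False using far hd1 by simp
qed

text \<open>By Krein-Milman the cut polytope is the hull of its extreme points, and these are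
  vertices of the whole polytope.\<close>

lemma lower_part_base_polytope:
  fixes M :: "'n::finite indep_system" and k :: nat
  assumes M: "matroid M"
  shows "base_polytope M \<inter> {x. incidence S \<bullet> x \<le> k}
    = convex hull (incidence ` {B \<in> bases M. card (B \<inter> S) \<le> k})" (is "?K = convex hull ?V")
proof
  have "compact (base_polytope M)"
    unfolding base_polytope_eq by (intro finite_imp_compact_convex_hull) simp
  then have "compact ?K" by (intro compact_Int_closed closed_halfspace_le)
  moreover have cK: "convex ?K"
    unfolding base_polytope_eq by (intro convex_Int convex_convex_hull convex_halfspace_le)
  ultimately have K: "?K = convex hull {v. v extreme_point_of ?K}"
    by (rule Krein_Milman_Minkowski)
  have "{v. v extreme_point_of ?K} \<subseteq> ?V"
  proof
    fix v assume "v \<in> {v. v extreme_point_of ?K}"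
    then have ext: "v extreme_point_of ?K" by simp
    obtain B where B: "B \<in> bases M" "v = incidence B"
      using extreme_point_is_vertex[OF M ext] by blast
    moreover have "incidence S \<bullet> v \<le> k" using ext by (auto simp: extreme_point_of_def)
    ultimately show "v \<in> ?V" by (auto simp: inner_incidence_incidence)
  qed
  then have "convex hull {v. v extreme_point_of ?K} \<subseteq> convex hull ?V" by (rule hull_mono)
  with K show "?K \<subseteq> convex hull ?V" by (rule ord_eq_le_trans)
  have "?V \<subseteq> ?K"
    unfolding base_polytope_eq by (auto simp: inner_incidence_incidence intro: hull_inc)
  then show "convex hull ?V \<subseteq> ?K" using cK by (rule hull_minimal)
qed

lemma upper_part_eq_lower_part_Compl:
  fixes M :: "'n::finite indep_system" and k :: nat
  assumes M: "matroid M" and k: "k \<le> matroid_rank M"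
  shows "base_polytope M \<inter> {x. incidence S \<bullet> x \<ge> k}
    = base_polytope M \<inter> {x. incidence (- S) \<bullet> x \<le> (matroid_rank M - k :: nat)}"
  using inner_Compl_on_base_polytope[OF M, of _ S] k by (auto simp: of_nat_diff)

section \<open>Reading a split off the bases\<close>

lemma base_polytope_eq_hull_iff:
  fixes N :: "'n::finite indep_system"
  shows "base_polytope N = convex hull (incidence ` F) \<longleftrightarrow> bases N = F"
  unfolding base_polytope_eq by (metis incidence_in_hull_iff set_eqI)

lemma base_polytope_subset_halfspace_iff:
  fixes M :: "'n::finite indep_system" and k :: nat
  shows "base_polytope M \<subseteq> {x. incidence S \<bullet> x \<le> k} \<longleftrightarrow> (\<forall>B\<in>bases M. card (B \<inter> S) \<le> k)"
    and "base_polytope M \<subseteq> {x. incidence S \<bullet> x \<ge> k} \<longleftrightarrow> (\<forall>B\<in>bases M. card (B \<inter> S) \<ge> k)"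
proof -
  have *: "base_polytope M \<subseteq> X \<longleftrightarrow> incidence ` bases M \<subseteq> X" if "convex X" for X
    unfolding base_polytope_eq using that by (metis hull_minimal hull_subset subset_trans)
  show "base_polytope M \<subseteq> {x. incidence S \<bullet> x \<le> k} \<longleftrightarrow> (\<forall>B\<in>bases M. card (B \<inter> S) \<le> k)"
    by (subst *) (auto simp: inner_incidence_incidence convex_halfspace_le)
  show "base_polytope M \<subseteq> {x. incidence S \<bullet> x \<ge> k} \<longleftrightarrow> (\<forall>B\<in>bases M. card (B \<inter> S) \<ge> k)"
    by (subst *) (auto simp: inner_incidence_incidence convex_halfspace_ge)
qed

text \<open>The component \<open>d\<close> of \<open>a\<close> orthogonal to \<open>h\<close> is a
  direction inside the hyperplane, so \<open>a\<close> is orthogonal to it as well and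
  \<open>d\<close> vanishes. Needed because a split may use any equation of
  \<open>H\<close>.\<close>

lemma hyperplane_eq_imp_proportional:
  fixes a h :: "'v::euclidean_space"
  assumes eq: "{x. h \<bullet> x = k} = {x. a \<bullet> x = b}" and h: "h \<noteq> 0" and a: "a \<noteq> 0"
  obtains c where "c \<noteq> 0" "a = c *\<^sub>R h" "b = c * k"
proof -
  have hh: "h \<bullet> h > 0" using h by simp
  define p where "p = (k / (h \<bullet> h)) *\<^sub>R h"
  define c where "c = (a \<bullet> h) / (h \<bullet> h)"
  have p: "h \<bullet> p = k" using hh by (simp add: p_def)
  then have ap: "a \<bullet> p = b" using eq by blast
  define d where "d = a - c *\<^sub>R h"
  have hd: "h \<bullet> d = 0" using hh by (simp add: d_def c_def inner_diff_right inner_commute)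
  then have "h \<bullet> (p + d) = k" using p by (simp add: inner_add_right)
  then have "a \<bullet> (p + d) = b" using eq by blast
  then have "a \<bullet> d = 0" using ap by (simp add: inner_add_right)
  then have "d \<bullet> d = 0" using hd by (simp add: d_def inner_diff_left)
  then have ac: "a = c *\<^sub>R h" by (simp add: d_def)
  moreover have "c \<noteq> 0" using a ac by auto
  moreover have "b = c * k" using ap p ac by simp
  ultimately show thesis using that by blast
qed

lemma hyperplane_split_iff_sides:
  fixes M :: "'n::finite indep_system" and k :: nat
  assumes k: "k > 0"
  shows "hyperplane_split M {x. incidence S \<bullet> x = k} \<longleftrightarrow>
     (\<exists>M1. matroid M1 \<and> ground M1 = UNIV \<and>
       base_polytope M1 = base_polytope M \<inter> {x. incidence S \<bullet> x \<le> k}) \<and>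
     (\<exists>M2. matroid M2 \<and> ground M2 = UNIV \<and>
       base_polytope M2 = base_polytope M \<inter> {x. incidence S \<bullet> x \<ge> k}) \<and>
     (\<exists>B\<in>bases M. card (B \<inter> S) < k) \<and> (\<exists>B\<in>bases M. card (B \<inter> S) > k)"
    (is "_ \<longleftrightarrow> ?lower \<and> ?upper \<and> ?less \<and> ?greater")
proof
  let ?P = "base_polytope M" and ?h = "incidence S"
  assume "hyperplane_split M {x. ?h \<bullet> x = k}"
  then obtain a b M1 M2 where a: "a \<noteq> 0" and H: "{x. ?h \<bullet> x = k} = {x. a \<bullet> x = b}"
    and m: "matroid M1" "ground M1 = UNIV" "matroid M2" "ground M2 = UNIV"
    and p: "base_polytope M1 = ?P \<inter> {x. a \<bullet> x \<le> b}" "base_polytope M2 = ?P \<inter> {x. a \<bullet> x \<ge> b}"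
    and f: "base_polytope M1 \<inter> base_polytope M2 \<noteq> base_polytope M1"
      "base_polytope M1 \<inter> base_polytope M2 \<noteq> base_polytope M2"
    unfolding hyperplane_split_def proper_face_of_def by blast
  \<comment> \<open>A point of \<open>H\<close>. If \<open>?h\<close> were zero, \<open>H\<close>
    would be empty because \<open>k > 0\<close>.\<close>
  have "a \<bullet> ((b / (a \<bullet> a)) *\<^sub>R a) = b" using a by simp
  then have "?h \<bullet> ((b / (a \<bullet> a)) *\<^sub>R a) = k" using H by blast
  then have "?h \<noteq> 0" using k by auto
  then obtain c where c: "c \<noteq> 0" "a = c *\<^sub>R ?h" "b = c * k"
    using hyperplane_eq_imp_proportional[OF H _ a] by blast
  \<comment> \<open>If the polytope lay in one closed halfspace, the piece on the other side would
    coincide with the common face, which would not be proper.\<close>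
  have np: "\<not> ?P \<subseteq> {x. a \<bullet> x \<ge> b}" "\<not> ?P \<subseteq> {x. a \<bullet> x \<le> b}"
    using f unfolding p by blast+
  \<comment> \<open>A negative \<open>c\<close> exchanges the two sides, and \<open>M1\<close> and
    \<open>M2\<close> with them.\<close>
  consider "c > 0" | "c < 0" using c(1) by linarith
  then show "?lower \<and> ?upper \<and> ?less \<and> ?greater"
  proof cases
    case 1
    then have "{x. a \<bullet> x \<le> b} = {x. ?h \<bullet> x \<le> k}" "{x. a \<bullet> x \<ge> b} = {x. ?h \<bullet> x \<ge> k}"
      unfolding c by simp_all
    then show ?thesis using m p np base_polytope_subset_halfspace_iff[where M = M and S = S and k = k]
      by (metis not_le)
  next
    case 2
    then have "{x. a \<bullet> x \<le> b} = {x. ?h \<bullet> x \<ge> k}" "{x. a \<bullet> x \<ge> b} = {x. ?h \<bullet> x \<le> k}"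
      unfolding c by simp_all
    then show ?thesis using m p np base_polytope_subset_halfspace_iff[where M = M and S = S and k = k]
      by (metis not_le)
  qed
next
  let ?P = "base_polytope M" and ?h = "incidence S"
  assume R: "?lower \<and> ?upper \<and> ?less \<and> ?greater"
  then obtain M1 M2 where m: "matroid M1" "ground M1 = UNIV" "matroid M2" "ground M2 = UNIV"
    and p: "base_polytope M1 = ?P \<inter> {x. ?h \<bullet> x \<le> k}" "base_polytope M2 = ?P \<inter> {x. ?h \<bullet> x \<ge> k}"
    by blast
  have "?h \<noteq> 0"
  proof
    assume "?h = 0"
    then have "S = {}" by (metis incidence_nth zero_index zero_neq_one ex_in_conv)
    then show False using R by auto
  qed
  moreover have "?P = base_polytope M1 \<union> base_polytope M2" unfolding p by auto
  moreover have face: "base_polytope M1 \<inter> base_polytope M2 = base_polytope M1 \<inter> {x. ?h \<bullet> x = k}"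
    "base_polytope M1 \<inter> base_polytope M2 = base_polytope M2 \<inter> {x. ?h \<bullet> x = k}"
    unfolding p by auto
  have conv: "convex (base_polytope N)" for N :: "'n indep_system" by (simp add: base_polytope_eq)
  have "base_polytope M1 \<inter> base_polytope M2 face_of base_polytope M1"
    unfolding face(1) using p by (intro face_of_Int_supporting_hyperplane_le conv) auto
  moreover have "base_polytope M1 \<inter> base_polytope M2 face_of base_polytope M2"
    unfolding face(2) using p by (intro face_of_Int_supporting_hyperplane_ge conv) auto
  moreover have "\<not> ?P \<subseteq> {x. ?h \<bullet> x \<ge> k}" "\<not> ?P \<subseteq> {x. ?h \<bullet> x \<le> k}"
    using R base_polytope_subset_halfspace_iff[where M = M and S = S and k = k] by (meson not_le)+
  then have "base_polytope M1 \<inter> base_polytope M2 \<noteq> base_polytope M1"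
    "base_polytope M1 \<inter> base_polytope M2 \<noteq> base_polytope M2"
    unfolding p by force+
  ultimately show "hyperplane_split M {x. ?h \<bullet> x = k}"
    unfolding hyperplane_split_def proper_face_of_def
    using m p by (intro exI[of _ ?h] exI[of _ "real k"] exI[of _ M1] exI[of _ M2]) auto
qed

lemma hyperplane_split_iff_cross_closed:
  fixes M :: "'n::finite indep_system" and k :: nat
  assumes M: "matroid M" and k: "k > 0"
  shows "hyperplane_split M {x. incidence S \<bullet> x = k} \<longleftrightarrow>
     (\<exists>B\<in>bases M. card (B \<inter> S) < k) \<and> (\<exists>B\<in>bases M. card (B \<inter> S) > k) \<and> cross_closed M S k"
proof (cases "\<exists>B\<in>bases M. card (B \<inter> S) > k")
  case False
  then show ?thesis unfolding hyperplane_split_iff_sides[OF k] by blast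
next
  case True
  let ?r = "matroid_rank M"
  obtain B where B: "B \<in> bases M" "card (B \<inter> S) > k" using True by blast
  \<comment> \<open>Makes the natural number \<open>?r - k\<close> a true difference, so the upper
    side for \<open>S\<close> is the lower side for \<open>- S\<close> at level
    \<open>?r - k\<close>.\<close>
  have kr: "k \<le> ?r"
    using card_Int_Compl[of B S] B bases_iff_card[OF M] by simp
  have upper: "card (B \<inter> - S) \<le> ?r - k" using card_Int_Compl[of B S] B bases_iff_card[OF M] by simp
  have lower_iff: "base_polytope N = base_polytope M \<inter> {x. incidence S \<bullet> x \<le> k} \<longleftrightarrow>
      bases N = {B \<in> bases M. card (B \<inter> S) \<le> k}" for N
    unfolding lower_part_base_polytope[OF M] base_polytope_eq_hull_iff ..
  have upper_iff: "base_polytope N = base_polytope M \<inter> {x. incidence S \<bullet> x \<ge> k} \<longleftrightarrow>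
      bases N = {B \<in> bases M. card (B \<inter> - S) \<le> ?r - k}" for N
    unfolding upper_part_eq_lower_part_Compl[OF M kr] lower_part_base_polytope[OF M]
      base_polytope_eq_hull_iff ..
  show ?thesis
    unfolding hyperplane_split_iff_sides[OF k] lower_iff upper_iff
  proof (intro iffI; elim conjE; intro conjI)
    assume "\<exists>M1. matroid M1 \<and> ground M1 = UNIV \<and> bases M1 = {B \<in> bases M. card (B \<inter> S) \<le> k}"
    then show "cross_closed M S k" using cross_closed_if_lower_bases[OF M] by blast
  next
    assume "\<exists>B\<in>bases M. card (B \<inter> S) < k" and cc: "cross_closed M S k"
    then have "\<exists>B\<in>bases M. card (B \<inter> S) \<le> k" by (meson less_imp_le)
    then obtain N where "matroid N" "ground N = UNIV" "bases N = {B \<in> bases M. card (B \<inter> S) \<le> k}"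
      by (rule lower_bases_matroid[OF M cc])
    then show "\<exists>M1. matroid M1 \<and> ground M1 = UNIV \<and> bases M1 = {B \<in> bases M. card (B \<inter> S) \<le> k}"
      by blast
    have "\<exists>B\<in>bases M. card (B \<inter> - S) \<le> ?r - k" using B(1) upper by blast
    then obtain N where "matroid N" "ground N = UNIV"
        "bases N = {B \<in> bases M. card (B \<inter> - S) \<le> ?r - k}"
      by (rule lower_bases_matroid[OF M cross_closed_Compl[OF M cc kr]])
    then show "\<exists>M2. matroid M2 \<and> ground M2 = UNIV \<and>
        bases M2 = {B \<in> bases M. card (B \<inter> - S) \<le> ?r - k}"
      by blast
  qed
qed

section \<open>Ranks and contractions\<close>

text \<open>A largest independent subset of \<open>X\<close> extends to a basis, so the rank of
  \<open>X\<close> is the largest intersection of a basis with \<open>X\<close>.\<close>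

lemma basis_meeting_iff_rank:
  assumes M: "matroid M"
  shows "(\<exists>B\<in>bases M. card (B \<inter> X) > m) \<longleftrightarrow> rank_fn M X > m"
proof
  assume "\<exists>B\<in>bases M. card (B \<inter> X) > m"
  then obtain B where B: "B \<in> bases M" "card (B \<inter> X) > m" by blast
  have "B \<inter> X \<in> indeps M" using indep_subset[OF M basis_indep[OF B(1)]] by blast
  then have "card (B \<inter> X) \<le> rank_fn M X" by (intro rank_fn_ge[OF M]) auto
  then show "rank_fn M X > m" using B by simp
next
  assume m: "rank_fn M X > m"
  obtain I where I: "I \<in> indeps M" "I \<subseteq> X" "card I = rank_fn M X"
    by (rule rank_fn_attained[OF M])
  obtain B0 where "B0 \<in> bases M" using bases_nonempty[OF M] by blast
  then obtain B where B: "B \<in> bases M" "I \<subseteq> B"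
    by (rule indep_extend_to_basis[OF M I(1)])
  have "card I \<le> card (B \<inter> X)"
    using B I finite_indep[OF M basis_indep[OF B(1)]] by (intro card_mono) auto
  then have "card (B \<inter> X) > m" using I(3) m by linarith
  then show "\<exists>B\<in>bases M. card (B \<inter> X) > m" using B(1) by blast
qed

lemma bases_restriction_indep:
  assumes "matroid M" "I \<in> indeps M"
  shows "bases (restriction M I) = {I}"
  using assms by (auto simp: bases_def restriction_def)

text \<open>An independent \<open>I\<close> is the only basis of its own restriction, and subsets of
  \<open>- S\<close> avoid \<open>I\<close> automatically.\<close>

lemma restriction_contraction:
  fixes M :: "'n indep_system"
  assumes M: "matroid M" "ground M = UNIV" and I: "I \<in> indeps M" "I \<subseteq> S"
  shows "restriction (contraction M I) (- S)
    = \<lparr>ground = - S, indeps = {J. J \<subseteq> - S \<and> J \<union> I \<in> indeps M}\<rparr>"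
proof -
  have "(UNIV - I) \<inter> - S = - S" using I by blast
  moreover have "J \<subseteq> UNIV - I \<and> J \<subseteq> - S \<longleftrightarrow> J \<subseteq> - S" for J using I by blast
  then have "{K. (K \<subseteq> UNIV - I \<and> K \<union> I \<in> indeps M) \<and> K \<subseteq> - S} = {J. J \<subseteq> - S \<and> J \<union> I \<in> indeps M}"
    by blast
  ultimately show ?thesis
    unfolding contraction_def bases_restriction_indep[OF M(1) I(1)]
    by (simp add: restriction_def M(2))
qed

text \<open>Any \<open>J\<close> counted by the rank satisfies
  \<open>card J + card I \<le> matroid_rank M\<close>, and equality means that \<open>J\<close>
  completes \<open>I\<close> to a basis whose trace on \<open>S\<close> is \<open>I\<close>.\<close>

lemma rank_restriction_contraction_iff:
  fixes M :: "'n::finite indep_system"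
  assumes M: "matroid M" "ground M = UNIV" and I: "I \<in> indeps M" "I \<subseteq> S"
  shows "int (matroid_rank (restriction (contraction M I) (- S))) = int (matroid_rank M) - int (card I)
    \<longleftrightarrow> (\<exists>B\<in>bases M. B \<inter> S = I)"
proof -
  let ?F = "{J. J \<subseteq> - S \<and> J \<union> I \<in> indeps M}"
  have rank: "matroid_rank (restriction (contraction M I) (- S)) = Max (card ` ?F)"
    unfolding restriction_contraction[OF assms] matroid_rank_def rank_fn_def
    by (rule arg_cong[where f = "\<lambda>X. Max (card ` X)"]) auto
  have "{} \<in> ?F" using I by simp
  then have ne: "card ` ?F \<noteq> {}" by blast
  have cU: "card (J \<union> I) = card J + card I" if "J \<subseteq> - S" for J
    using that I by (intro card_Un_disjoint) auto
  have bd: "card J + card I \<le> matroid_rank M" if "J \<in> ?F" for J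
    using that card_indep_le[OF M(1), of "J \<union> I"] cU[of J] by simp
  show ?thesis unfolding rank
  proof
    assume eq: "int (Max (card ` ?F)) = int (matroid_rank M) - int (card I)"
    have "Max (card ` ?F) \<in> card ` ?F" by (rule Max_in) (use ne in auto)
    then obtain J where J: "J \<in> ?F" "Max (card ` ?F) = card J" by blast
    then have "card (J \<union> I) = matroid_rank M" using eq cU[of J] by simp
    then have "J \<union> I \<in> bases M" using J bases_iff_card[OF M(1)] by simp
    moreover have "(J \<union> I) \<inter> S = I" using J I by auto
    ultimately show "\<exists>B\<in>bases M. B \<inter> S = I" by blast
  next
    assume "\<exists>B\<in>bases M. B \<inter> S = I"
    then obtain B where B: "B \<in> bases M" "B \<inter> S = I" by blast
    have "B - S \<union> I = B" using B by blast
    then have mem: "B - S \<in> ?F" using B bases_iff_card[OF M(1)] by auto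
    have c: "card (B - S) + card I = matroid_rank M"
      using \<open>B - S \<union> I = B\<close> cU[of "B - S"] B bases_iff_card[OF M(1)] by (metis Diff_eq inf_le2)
    have "Max (card ` ?F) = card (B - S)"
    proof (rule Max_eqI)
      fix y assume "y \<in> card ` ?F"
      then obtain J where "J \<in> ?F" "y = card J" by blast
      then show "y \<le> card (B - S)" using bd[of J] c by linarith
    qed (use mem in auto)
    then show "int (Max (card ` ?F)) = int (matroid_rank M) - int (card I)" using c by simp
  qed
qed

lemma cross_closed_iff_contractions:
  fixes M :: "'n::finite indep_system"
  assumes M: "matroid M" "ground M = UNIV"
  shows "cross_closed M S k \<longleftrightarrow>
     (\<forall>I1 I2. I1 \<in> indeps M \<and> I1 \<subseteq> S \<and> card I1 = k \<and>
              I2 \<in> indeps M \<and> I2 \<subseteq> S \<and> card I2 = k \<and>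
              (\<exists>B\<in>bases M. B \<inter> S = I1) \<and> (\<exists>B\<in>bases M. B \<inter> S = I2) \<longrightarrow>
        restriction (contraction M I1) (- S) = restriction (contraction M I2) (- S))"
    (is "_ \<longleftrightarrow> ?R")
proof
  assume cc: "cross_closed M S k"
  \<comment> \<open>Extending \<open>J \<union> B1 \<inter> S\<close> inside \<open>B1\<close> adds
    nothing in \<open>S\<close>, so the resulting basis is still at level \<open>k\<close> and can
    be crossed with \<open>B2\<close>.\<close>
  have step: "J \<union> B2 \<inter> S \<in> indeps M"
    if B: "B1 \<in> bases M" "B2 \<in> bases M" "card (B1 \<inter> S) = k" "card (B2 \<inter> S) = k"
      and J: "J \<subseteq> - S" "J \<union> B1 \<inter> S \<in> indeps M" for B1 B2 J
  proof -
    obtain C where C: "C \<in> bases M" "J \<union> B1 \<inter> S \<subseteq> C" "C \<subseteq> (J \<union> B1 \<inter> S) \<union> B1"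
      using indep_extend_to_basis[OF M(1) J(2) B(1)] .
    then have "C \<inter> S = B1 \<inter> S" using J(1) by blast
    then have "(B2 \<inter> S) \<union> (C - S) \<in> bases M" using cc B C(1) by (simp add: cross_closed_def)
    moreover have "J \<union> B2 \<inter> S \<subseteq> (B2 \<inter> S) \<union> (C - S)" using C(2) J(1) by blast
    ultimately show ?thesis using indep_subset[OF M(1)] basis_indep by blast
  qed
  show ?R
  proof (intro allI impI, elim conjE bexE)
    fix I1 I2 B1 B2
    assume I: "I1 \<in> indeps M" "I1 \<subseteq> S" "card I1 = k" "I2 \<in> indeps M" "I2 \<subseteq> S" "card I2 = k"
      and B: "B1 \<in> bases M" "B1 \<inter> S = I1" "B2 \<in> bases M" "B2 \<inter> S = I2"
    have "J \<union> I1 \<in> indeps M \<longleftrightarrow> J \<union> I2 \<in> indeps M" if "J \<subseteq> - S" for J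
      using step[of B1 B2 J] step[of B2 B1 J] that I B by auto
    then show "restriction (contraction M I1) (- S) = restriction (contraction M I2) (- S)"
      unfolding restriction_contraction[OF M I(1,2)] restriction_contraction[OF M I(4,5)] by auto
  qed
next
  assume R: ?R
  show "cross_closed M S k"
    unfolding cross_closed_def
  proof (intro ballI impI)
    fix B C
    assume B: "B \<in> bases M" "card (B \<inter> S) = k" and C: "C \<in> bases M" "card (C \<inter> S) = k"
    have I: "B \<inter> S \<in> indeps M" "C \<inter> S \<in> indeps M"
      using indep_subset[OF M(1) basis_indep] B C by blast+
    have "restriction (contraction M (B \<inter> S)) (- S) = restriction (contraction M (C \<inter> S)) (- S)"
      using R B C I by blast
    then have eq: "{J. J \<subseteq> - S \<and> J \<union> B \<inter> S \<in> indeps M} = {J. J \<subseteq> - S \<and> J \<union> C \<inter> S \<in> indeps M}"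
      using restriction_contraction[OF M I(1)] restriction_contraction[OF M I(2)] by simp
    have "(C - S) \<union> C \<inter> S = C" by blast
    \<comment> \<open>\<open>C - S\<close> completes \<open>C \<inter> S\<close>, hence by equality
      of the contractions it is independent together with \<open>B \<inter> S\<close>; its size
      makes the union a basis.\<close>
    then have "C - S \<in> {J. J \<subseteq> - S \<and> J \<union> C \<inter> S \<in> indeps M}"
      using C basis_indep by auto
    then have "(C - S) \<union> B \<inter> S \<in> indeps M" unfolding eq[symmetric] by blast
    moreover have "card ((C - S) \<union> B \<inter> S) = card (C - S) + card (B \<inter> S)"
      by (intro card_Un_disjoint) auto
    moreover have "card (C \<inter> S) + card (C - S) = card C"
      using card_Int_Compl[of C S] by (simp add: Diff_eq)
    ultimately show "(B \<inter> S) \<union> (C - S) \<in> bases M"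
      using B C bases_iff_card[OF M(1)] by (simp add: Un_commute)
  qed
qed

theorem theorem4p1:
  fixes M :: "'n::finite indep_system" and S :: "'n set" and r k :: nat
    and H :: "(real ^ 'n) set"
  assumes "matroid M" and "ground M = UNIV" and "matroid_rank M = r"
    and "k > 0"
    and "H = {x. (\<Sum>e\<in>S. x $ e) = real k}"
  shows "hyperplane_split M H \<longleftrightarrow>
     (rank_fn M S > k \<and> int (rank_fn M (- S)) > int r - int k) \<and>
     (\<forall>I1 I2. I1 \<in> indeps M \<and> I1 \<subseteq> S \<and> card I1 = k \<and>
              I2 \<in> indeps M \<and> I2 \<subseteq> S \<and> card I2 = k \<and>
              int (matroid_rank (restriction (contraction M I1) (- S))) = int r - int k \<and>
              int (matroid_rank (restriction (contraction M I2) (- S))) = int r - int k \<longrightarrow>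
        restriction (contraction M I1) (- S) = restriction (contraction M I2) (- S))"
proof -
  note M = assms(1) and G = assms(2) and r = assms(3) and k = assms(4)
  have H: "H = {x. incidence S \<bullet> x = k}" using assms(5) by (simp add: inner_incidence)
  \<comment> \<open>The assumption on \<open>S\<close> gives \<open>k < r\<close>, so that natural
    and integer subtraction agree; a basis has fewer than \<open>k\<close> elements in
    \<open>S\<close> iff it has more than \<open>r - k\<close> outside.\<close>
  have less_iff: "(\<exists>B\<in>bases M. card (B \<inter> S) < k) \<longleftrightarrow> int (rank_fn M (- S)) > int r - int k"
    if "rank_fn M S > k"
  proof -
    obtain I where I: "I \<in> indeps M" "card I = rank_fn M S" by (rule rank_fn_attained[OF M])
    have kr: "k < r" using that card_indep_le[OF M I(1)] I(2) r by linarith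
    have "card (B \<inter> S) < k \<longleftrightarrow> card (B \<inter> - S) > r - k" if "B \<in> bases M" for B
    proof -
      have "card B = r" using that bases_iff_card[OF M] r by simp
      then show ?thesis using card_Int_Compl[of B S] kr by linarith
    qed
    then have "(\<exists>B\<in>bases M. card (B \<inter> S) < k) \<longleftrightarrow> rank_fn M (- S) > r - k"
      using basis_meeting_iff_rank[OF M, where X = "- S" and m = "r - k"] by blast
    then show ?thesis using kr by auto
  qed
  have rank: "int (matroid_rank (restriction (contraction M I) (- S))) = int r - int k
      \<longleftrightarrow> (\<exists>B\<in>bases M. B \<inter> S = I)" if "I \<in> indeps M" "I \<subseteq> S" "card I = k" for I
    using rank_restriction_contraction_iff[OF M G that(1,2)] that(3) r by simp
  have contr: "cross_closed M S k \<longleftrightarrow>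
     (\<forall>I1 I2. I1 \<in> indeps M \<and> I1 \<subseteq> S \<and> card I1 = k \<and>
              I2 \<in> indeps M \<and> I2 \<subseteq> S \<and> card I2 = k \<and>
              int (matroid_rank (restriction (contraction M I1) (- S))) = int r - int k \<and>
              int (matroid_rank (restriction (contraction M I2) (- S))) = int r - int k \<longrightarrow>
        restriction (contraction M I1) (- S) = restriction (contraction M I2) (- S))"
    unfolding cross_closed_iff_contractions[OF M G]
    by (simp add: rank cong: conj_cong)
  show ?thesis
    unfolding H hyperplane_split_iff_cross_closed[OF M k] contr[symmetric]
      basis_meeting_iff_rank[OF M]
    using less_iff by blast
qed

end
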